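(* Let $H\subset E$ and $(\nu_t)_{t>0}$, $(P_t)_{t\ge0}$, $\mathcal U=(U_\alpha)_{\alpha>0}$ be as in the context, with $\dim H=\infty$, and assume that (HS) and (H) hold. Then the hypothesis (L) of P.A. Meyer does not hold for the Lévy process on $E$ with transition function $(P_t)_{t\ge0}$: there is no finite measure on $(E,\mathcal B(E))$ with respect to which all the measures $U_\alpha(y,\cdot)$, $y\in E$, $\alpha>0$, are absolutely continuous.
   Context: $(H,\langle\cdot,\cdot\rangle)$ is a separable real Hilbert space with norm $|\cdot|$; $E$ is a Hilbert space with norm $\|\cdot\|$ such that $H\subset E$ continuously and densely; identifying $H$ with $H'$, $E'\subset H\subset E$; ${}_{E'}\langle\xi,z\rangle_E=\xi(z)$. (HS): the embedding $H\subset E$ is Hilbert–Schmidt. $\psi:H\to\mathbb C$ is a continuous negative definite function (so that $e^{-t\psi}$ is positive definite for each $t>0$) with $\psi(0)=0$. For $t>0$, $\nu_t$ is the probability measure on $(E,\mathcal B(E))$ with $\int_E e^{i\,{}_{E'}\langle\xi,z\rangle_E}\nu_t(dz)=e^{-t\psi(\xi)}$, $\xi\in E'$. $P_tf(y)=\int_Ef(y+w)\nu_t(dw)$, $P_0=\mathrm{Id}$, $U_\alpha=\int_0^\infty e^{-\alpha t}P_t\,dt$, and $U_\alpha(y,A)=U_\alpha1_A(y)$. (H): (i) there is $C>0$ such that $\int_E {}_{E'}\langle\xi,z\rangle_E^2\,\nu_t(dz)\le C(1+t^2)|\xi|^2$ for all $\xi\in E'$, $t>0$; (ii) $\nu_t(H)=0$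 for all $t>0$. *)

theory Defs
  imports "HOL-Probability.Probability"
begin

definition orthonormal_basis :: "'a::real_inner set \<Rightarrow> bool" where
  "orthonormal_basis B \<longleftrightarrow>
     pairwise orthogonal B \<and> (\<forall>b\<in>B. norm b = 1) \<and> closure (span B) = UNIV"

definition hilbert_schmidt :: "('a::real_inner \<Rightarrow> 'b::real_inner) \<Rightarrow> bool" where
  "hilbert_schmidt T \<longleftrightarrow> bounded_linear T \<and>
     (\<exists>B. orthonormal_basis B \<and> (\<lambda>b. (norm (T b))\<^sup>2) summable_on B)"

text \<open>
  An inclusion \<open>H \<subset> E\<close> of Hilbert spaces is given by an injective map \<open>j\<close> from \<open>H\<close> to \<open>E\<close>.
\<close>

definition dense_continuous_embedding :: "('h::real_inner \<Rightarrow> 'e::real_inner) \<Rightarrow> bool" where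
  "dense_continuous_embedding j \<longleftrightarrow> bounded_linear j \<and> inj j \<and> closure (range j) = UNIV"

text \<open>
  The inclusion \<open>E' \<subset> H\<close> that results from identifying \<open>H\<close> with its dual: a functional \<open>\<xi>\<close> on \<open>E\<close>
  is sent to the Riesz representative of its restriction to \<open>H\<close>, which exists and is unique
  if \<open>H\<close> is complete and \<open>j\<close> is bounded.
\<close>

definition dual_incl :: "('h::real_inner \<Rightarrow> 'e::real_inner) \<Rightarrow> ('e \<Rightarrow>\<^sub>L real) \<Rightarrow> 'h" where
  "dual_incl j \<xi> = (THE h. \<forall>x. blinfun_apply \<xi> (j x) = inner h x)"

text \<open>Negative definiteness in the sense of Schoenberg (as in Berg and Forst).\<close>

definition negative_definite :: "('a::ab_group_add \<Rightarrow> complex) \<Rightarrow> bool" where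
  "negative_definite \<psi> \<longleftrightarrow>
     (\<forall>(n::nat) (x :: nat \<Rightarrow> 'a) (c :: nat \<Rightarrow> complex).
        (\<Sum>k<n. \<Sum>l<n. (\<psi> (x k) + cnj (\<psi> (x l)) - \<psi> (x k - x l)) * c k * cnj (c l))
          \<in> \<real>\<^sub>\<ge>\<^sub>0)"

definition transition_op ::
    "(real \<Rightarrow> 'e measure) \<Rightarrow> real \<Rightarrow> ('e::real_normed_vector \<Rightarrow> ennreal) \<Rightarrow> 'e \<Rightarrow> ennreal" where
  "transition_op \<nu> t f y = (if t = 0 then f y else (\<integral>\<^sup>+w. f (y + w) \<partial>\<nu> t))"

definition resolvent_op ::
    "(real \<Rightarrow> 'e measure) \<Rightarrow> real \<Rightarrow> ('e::real_normed_vector \<Rightarrow> ennreal) \<Rightarrow> 'e \<Rightarrow> ennreal" where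
  "resolvent_op \<nu> \<alpha> f y =
     (\<integral>\<^sup>+t\<in>{0..}. ennreal (exp (- \<alpha> * t)) * transition_op \<nu> t f y \<partial>lborel)"

definition resolvent_kernel ::
    "(real \<Rightarrow> 'e measure) \<Rightarrow> real \<Rightarrow> 'e::real_normed_vector \<Rightarrow> 'e set \<Rightarrow> ennreal" where
  "resolvent_kernel \<nu> \<alpha> y A = resolvent_op \<nu> \<alpha> (indicator A) y"

text \<open>
  Meyer's hypothesis (L) for a resolvent of kernels. Since \<open>U \<alpha> y\<close> is a set function and not an
  element of the type of measures, absolute continuity is written out through null sets.
\<close>

definition hypothesis_L :: "(real \<Rightarrow> 'e \<Rightarrow> 'e::topological_space set \<Rightarrow> ennreal) \<Rightarrow> bool" where
  "hypothesis_L U \<longleftrightarrow>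
     (\<exists>\<mu> :: 'e measure. sets \<mu> = sets borel \<and> finite_measure \<mu> \<and>
        (\<forall>\<alpha>>0. \<forall>y. \<forall>A\<in>null_sets \<mu>. U \<alpha> y A = 0))"

end

theory Submission
  imports Defs
begin

text \<open>
  Since \<open>j\<close> is Hilbert-Schmidt, \<open>E\<close> contains an orthonormal sequence \<open>f\<close> along which the adjoint
  of \<open>j\<close> decays as fast as desired. By Chebyshev's inequality and (H)(i), the cube
  \<open>K = {z. \<forall>n. \<bar>inner (f n) z\<bar> \<le> (1/2) ^ n}\<close> then satisfies \<open>\<nu> t K \<ge> 1/2\<close> for all \<open>t\<close> in
  \<open>{0<..1}\<close>, so \<open>U 1 y (y + K)\<close> is positive for every \<open>y\<close>. But \<open>K\<close> has uncountably many
  pairwise disjoint translates, and under a finite measure one of them is a null set.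
\<close>

section \<open>Riesz representation and the inclusion of the dual of \<open>E\<close> in
  \<open>H\<close>\<close>

text \<open>The representing vector is found as a minimiser of a quadratic functional. The
  parallelogram identity makes a minimising sequence Cauchy, and the first variation vanishes at its
  limit.\<close>

lemma riesz_representation:
  fixes f :: "'a::{real_inner, banach} \<Rightarrow> real"
  assumes "bounded_linear f"
  shows "\<exists>h. \<forall>x. f x = inner h x"
proof -
  interpret f: bounded_linear f by fact
  \<comment> \<open>If \<open>f\<close> is \<open>inner h\<close>, then \<open>Q x\<close> equals
    \<open>(norm (x - h))\<^sup>2 - (norm h)\<^sup>2\<close>, so the minimiser of \<open>Q\<close>
    is the vector sought.\<close>
  define Q where "Q x = (norm x)\<^sup>2 - 2 * f x" for x
  obtain K where K: "\<And>x. norm (f x) \<le> norm x * K"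
    using f.bounded by blast
  have lower: "- K\<^sup>2 \<le> Q x" for x
  proof -
    have "2 * f x \<le> 2 * (norm x * K)"
      using K[of x] by simp
    moreover have "0 \<le> (norm x - K)\<^sup>2"
      by simp
    ultimately show ?thesis
      by (simp add: Q_def power2_diff)
  qed
  define m where "m = Inf (range Q)"
  have bdd: "bdd_below (range Q)"
    using lower by (intro bdd_belowI2)
  have m_le: "m \<le> Q x" for x
    unfolding m_def using bdd by (intro cInf_lower) auto
  have parallelogram: "(norm (x - y))\<^sup>2 \<le> 2 * (Q x + Q y - 2 * m)" for x y
  proof -
    \<comment> \<open>The linear parts of \<open>Q\<close> cancel here, which leaves the
      parallelogram identity for the norm.\<close>
    have "Q x + Q y = 2 * Q ((1/2) *\<^sub>R (x + y)) + (norm (x - y))\<^sup>2 / 2"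
      by (simp add: Q_def f.add f.scaleR power2_norm_eq_inner inner_add_left inner_add_right
          inner_diff_left inner_diff_right inner_commute field_simps)
    then show ?thesis
      using m_le[of "(1/2) *\<^sub>R (x + y)"] by simp
  qed
  have "\<exists>x. Q x < m + 1 / real (Suc n)" for n
    using cInf_less_iff[OF _ bdd, of "m + 1 / real (Suc n)"] by (auto simp: m_def)
  then obtain X where X: "\<And>n. Q (X n) < m + 1 / real (Suc n)"
    by metis
  have "Cauchy X"
  proof (rule metric_CauchyI)
    fix e :: real
    assume "e > 0"
    then obtain N where "1 / real (Suc N) < e\<^sup>2 / 4"
      using nat_approx_posE[of "e\<^sup>2 / 4"] by auto
    moreover define r where "r = 1 / real (Suc N)"
    ultimately have r: "4 * r < e\<^sup>2"
      by simp
    have "dist (X k) (X n) < e" if "k \<ge> N" "n \<ge> N" for k n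
    proof -
      have "Q (X i) < m + r" if "i \<ge> N" for i
        using X[of i] that unfolding r_def by (smt (verit) frac_le of_nat_0_less_iff of_nat_le_iff Suc_le_mono zero_less_Suc)
      from this[OF that(1)] this[OF that(2)] have "2 * (Q (X k) + Q (X n) - 2 * m) < 4 * r"
        by simp
      then have "(norm (X k - X n))\<^sup>2 < e\<^sup>2"
        using parallelogram[of "X k" "X n"] r by (meson le_less_trans less_trans)
      then show ?thesis
        using \<open>e > 0\<close> by (simp add: dist_norm power2_less_imp_less)
    qed
    then show "\<exists>M. \<forall>k\<ge>M. \<forall>n\<ge>M. dist (X k) (X n) < e"
      by blast
  qed
  then obtain h where h: "X \<longlonglongrightarrow> h"
    using Cauchy_convergent convergent_def by blast
  have "(\<lambda>n. Q (X n)) \<longlonglongrightarrow> Q h"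
    unfolding Q_def by (intro tendsto_intros f.tendsto h)
  moreover have "(\<lambda>n. m + 1 / real (Suc n)) \<longlonglongrightarrow> m + 0"
    by (intro tendsto_intros LIMSEQ_Suc lim_1_over_n)
  ultimately have "Q h \<le> m + 0"
    using X by (intro LIMSEQ_le[of "\<lambda>n. Q (X n)"]) (auto intro: less_imp_le)
  then have h_min: "Q h \<le> Q x" for x
    using m_le[of x] by simp
  have "f x = inner h x" for x
  proof (cases "x = 0")
    case True
    then show ?thesis by simp
  next
    case False
    define d where "d = inner h x - f x"
    \<comment> \<open>This \<open>t\<close> minimises the quadratic polynomial
      \<open>Q h + 2 * t * d + t\<^sup>2 * (norm x)\<^sup>2\<close>.\<close>
    define t where "t = - d / (norm x)\<^sup>2"
    have "Q (h + t *\<^sub>R x) = Q h + 2 * t * d + t\<^sup>2 * (norm x)\<^sup>2"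
      by (simp add: Q_def d_def f.add f.scaleR power2_norm_eq_inner inner_add_left inner_add_right
          inner_commute algebra_simps) (simp add: power2_eq_square)
    also have "\<dots> = Q h - d\<^sup>2 / (norm x)\<^sup>2"
      using False by (simp add: t_def field_simps power2_eq_square)
    finally have "d\<^sup>2 / (norm x)\<^sup>2 \<le> 0"
      using h_min[of "h + t *\<^sub>R x"] by simp
    then have "d = 0"
      using False by (simp add: divide_le_0_iff)
    then show ?thesis
      by (simp add: d_def)
  qed
  then show ?thesis by blast
qed

text \<open>Existence by Riesz and uniqueness by nondegeneracy of the inner product justify the
  definite description; all later facts about \<open>dual_incl\<close> come from this
  identity.\<close>

lemma inner_dual_incl:
  fixes j :: "'h::{real_inner, banach} \<Rightarrow> 'e::real_inner"
  assumes "bounded_linear j"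
  shows "inner (dual_incl j \<xi>) x = blinfun_apply \<xi> (j x)"
proof -
  have "bounded_linear (\<lambda>x. blinfun_apply \<xi> (j x))"
    using assms by (intro bounded_linear_compose[OF blinfun.bounded_linear_right])
  then obtain h where h: "\<forall>x. blinfun_apply \<xi> (j x) = inner h x"
    using riesz_representation by blast
  have "\<forall>x. blinfun_apply \<xi> (j x) = inner (dual_incl j \<xi>) x"
    unfolding dual_incl_def
  proof (rule theI[where P = "\<lambda>h. \<forall>x. blinfun_apply \<xi> (j x) = inner h x", OF h])
    fix h'
    assume "\<forall>x. blinfun_apply \<xi> (j x) = inner h' x"
    with h have "inner (h' - h) (h' - h) = 0"
      by (simp add: inner_diff_left)
    then show "h' = h" by simp
  qed
  then show ?thesis by simp
qed

section \<open>Orthonormal sequences in \<open>E\<close> along which the adjoint of \<open>j\<close>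
  decays\<close>

text \<open>One Gram-Schmidt step: a vector outside the span, minus its orthogonal projection onto
  the span, is nonzero and can be normalised.\<close>

lemma ex_unit_orthogonal_to_finite:
  fixes F :: "'a::real_inner set"
  assumes "finite F" and "span F \<noteq> UNIV"
  obtains e where "norm e = 1" and "\<And>x. x \<in> F \<Longrightarrow> inner e x = 0"
proof -
  obtain C where C: "finite C" "span C = span F" "pairwise orthogonal C"
    using basis_orthogonal[OF assms(1)] by blast
  obtain x where x: "x \<notin> span C"
    using assms(2) C(2) by blast
  define r where "r = x - (\<Sum>c\<in>C. (inner x c / inner c c) *\<^sub>R c)"
  have "(\<Sum>c\<in>C. (inner x c / inner c c) *\<^sub>R c) \<in> span C"
    by (intro span_sum span_scale span_base)
  then have "r \<noteq> 0"
    using x by (auto simp: r_def)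
  have "inner r c = 0" if "c \<in> C" for c
  proof -
    \<comment> \<open>The set \<open>C\<close> may contain 0. For \<open>b = c = 0\<close> both
      summands vanish, since division by zero yields 0.\<close>
    have "(\<Sum>b\<in>C. inner x b / inner b b * inner b c) = (\<Sum>b\<in>C. if b = c then inner x c else 0)"
      using C(3) that by (intro sum.cong) (auto simp: pairwise_def orthogonal_def)
    then show ?thesis
      using that C(1) by (simp add: r_def inner_diff_left inner_sum_left)
  qed
  then have "inner r y = 0" if "y \<in> span C" for y
    using that orthogonal_to_span[of y C r] by (auto simp: orthogonal_def)
  then have "inner (sgn r) y = 0" if "y \<in> F" for y
    using that C(2) span_base[of y F] by (simp add: sgn_div_norm)
  moreover have "norm (sgn r) = 1"
    using \<open>r \<noteq> 0\<close> by (simp add: norm_sgn)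
  ultimately show thesis
    using that by blast
qed

text \<open>Infinite dimension passes from \<open>H\<close> to \<open>E\<close>: \<open>j\<close>
  maps a basis of \<open>H\<close> to an independent set, which a finite spanning set of
  \<open>E\<close> would force to be finite.\<close>

lemma span_finite_neq_UNIV_of_inj:
  fixes j :: "'a::real_vector \<Rightarrow> 'b::real_vector" and F :: "'b set"
  assumes "linear j" and "inj j" and "\<not> (\<exists>B :: 'a set. finite B \<and> span B = UNIV)"
    and "finite F"
  shows "span F \<noteq> UNIV"
proof
  assume F: "span F = UNIV"
  obtain B :: "'a set" where B: "independent B" "UNIV \<subseteq> span B"
    by (rule maximal_independent_subset[of UNIV])
  have "inj_on j (span B)"
    using assms(2) by (rule inj_on_subset) simp
  then have "independent (j ` B)"
    using assms(1) B(1) by (intro linear_independent_injective_image)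
  then have "finite (j ` B)"
    using independent_span_bound[OF assms(4), of "j ` B"] F by simp
  then have "finite B"
    by (rule finite_imageD) (rule inj_on_subset[OF assms(2) subset_UNIV])
  then show False
    using B(2) assms(3) by (simp add: top_unique)
qed

text \<open>
  Vectors orthogonal to the images of the finitely many basis vectors that carry most of the
  Hilbert-Schmidt norm have a small image under the adjoint of \<open>j\<close>.
\<close>

lemma hilbert_schmidt_ex_small_dual:
  fixes j :: "'h::{real_inner, banach} \<Rightarrow> 'e::real_inner"
  assumes HS: "hilbert_schmidt j" and inf: "\<And>F :: 'e set. finite F \<Longrightarrow> span F \<noteq> UNIV"
    and "finite F" and "\<delta> > 0"
  obtains e where "norm e = 1" and "\<And>x. x \<in> F \<Longrightarrow> inner e x = 0"
    and "(norm (dual_incl j (blinfun_inner_right e)))\<^sup>2 \<le> \<delta>"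
proof -
  obtain B where j: "bounded_linear j" and orth: "pairwise orthogonal B"
    and norm1: "\<And>b. b \<in> B \<Longrightarrow> norm b = 1" and dense: "closure (span B) = UNIV"
    and summable: "(\<lambda>b. (norm (j b))\<^sup>2) summable_on B"
    using HS unfolding hilbert_schmidt_def orthonormal_basis_def by blast
  interpret j: bounded_linear j by fact
  define a where "a b = (norm (j b))\<^sup>2" for b
  obtain T where T: "finite T" "T \<subseteq> B" "dist (sum a T) (infsum a B) \<le> \<delta>"
    using infsum_finite_approximation[OF summable \<open>\<delta> > 0\<close>] unfolding a_def by blast
  have tail: "sum a G \<le> \<delta>" if "finite G" "G \<subseteq> B" "G \<inter> T = {}" for G
  proof -
    have "sum a (G \<union> T) \<le> infsum a B"
      using that T summable by (intro finite_sum_le_infsum) (auto simp: a_def[abs_def])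
    moreover have "sum a (G \<union> T) = sum a G + sum a T"
      using that T by (intro sum.union_disjoint)
    ultimately show ?thesis
      using T(3) by (simp add: dist_real_def)
  qed
  obtain e where e: "norm e = 1" "\<And>x. x \<in> F \<union> j ` T \<Longrightarrow> inner e x = 0"
    using ex_unit_orthogonal_to_finite[of "F \<union> j ` T"] inf assms(3) T(1) by blast
  define h where "h = dual_incl j (blinfun_inner_right e)"
  have h: "inner h x = inner e (j x)" for x
    unfolding h_def by (subst inner_dual_incl[OF j]) simp
  \<comment> \<open>The bound is proved on the dense span of \<open>B\<close> and extended to the
    whole space because \<open>S\<close> is closed. Taking \<open>v = h\<close> then bounds
    \<open>norm h\<close> itself.\<close>
  define S where "S = {v. inner h v \<le> sqrt \<delta> * norm v}"
  have "span B \<subseteq> S"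
  proof
    fix v
    assume "v \<in> span B"
    then obtain G c where G: "finite G" "G \<subseteq> B" and v: "v = (\<Sum>b\<in>G. c b *\<^sub>R b)"
      by (auto simp: span_explicit)
    have "pairwise (\<lambda>x y. orthogonal (c x *\<^sub>R x) (c y *\<^sub>R y)) G"
      using orth G(2) by (auto simp: pairwise_def orthogonal_def subset_iff)
    then have norm_v: "(norm v)\<^sup>2 = (\<Sum>b\<in>G. (c b)\<^sup>2)"
      unfolding v using G norm1
      by (subst norm_sum_Pythagorean) (auto intro!: sum.cong simp: power_mult_distrib)
    have "(\<Sum>b\<in>G. (inner e (j b))\<^sup>2) = (\<Sum>b\<in>G - T. (inner e (j b))\<^sup>2)"
      using G(1) e(2) by (intro sum.mono_neutral_right) auto
    also have "\<dots> \<le> (\<Sum>b\<in>G - T. a b)"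
      unfolding a_def power2_norm_eq_inner using e(1) Cauchy_Schwarz_ineq[of e]
      by (intro sum_mono) (simp add: norm_eq_1)
    also have "\<dots> \<le> \<delta>"
      using G by (intro tail) auto
    finally have coeff: "(\<Sum>b\<in>G. (inner e (j b))\<^sup>2) \<le> \<delta>" .
    have "(inner h v)\<^sup>2 = (\<Sum>b\<in>G. c b * inner e (j b))\<^sup>2"
      by (simp add: v inner_sum_right h)
    also have "\<dots> \<le> (norm v)\<^sup>2 * (\<Sum>b\<in>G. (inner e (j b))\<^sup>2)"
      unfolding norm_v by (rule Cauchy_Schwarz_ineq_sum)
    also have "\<dots> \<le> (norm v)\<^sup>2 * \<delta>"
      using coeff by (intro mult_left_mono) auto
    also have "\<dots> = (sqrt \<delta> * norm v)\<^sup>2"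
      using \<open>\<delta> > 0\<close> by (simp add: power_mult_distrib)
    finally show "v \<in> S"
      using \<open>\<delta> > 0\<close> unfolding S_def by (auto intro: power2_le_imp_le)
  qed
  moreover have "closed S"
    unfolding S_def by (intro closed_Collect_le continuous_intros)
  ultimately have "h \<in> S"
    using closure_minimal[of "span B" S] dense by blast
  then have "(norm h)\<^sup>2 \<le> sqrt \<delta> * norm h"
    by (simp add: S_def power2_norm_eq_inner)
  then have "norm h \<le> sqrt \<delta>"
    using \<open>\<delta> > 0\<close> by (cases "h = 0") (auto simp: power2_eq_square)
  then have "(norm h)\<^sup>2 \<le> \<delta>"
    using \<open>\<delta> > 0\<close> power_mono[of "norm h" "sqrt \<delta>" 2] by simp
  then show thesis
    using that e by (simp add: h_def)
qed

text \<open>Course-of-values recursion: the finite set to which the next vector has to be orthogonal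
  consists of the vectors already chosen.\<close>

lemma hilbert_schmidt_ex_orthonormal_seq:
  fixes j :: "'h::{real_inner, banach} \<Rightarrow> 'e::real_inner"
  assumes "hilbert_schmidt j" and "\<And>F :: 'e set. finite F \<Longrightarrow> span F \<noteq> UNIV"
    and "\<And>n::nat. \<delta> n > 0"
  shows "\<exists>f :: nat \<Rightarrow> 'e. (\<forall>m n. inner (f m) (f n) = (if m = n then 1 else 0)) \<and>
    (\<forall>n. (norm (dual_incl j (blinfun_inner_right (f n))))\<^sup>2 \<le> \<delta> n)"
proof -
  have "\<exists>f :: nat \<Rightarrow> 'e. \<forall>n. norm (f n) = 1 \<and> (\<forall>m<n. inner (f n) (f m) = 0) \<and>
      (norm (dual_incl j (blinfun_inner_right (f n))))\<^sup>2 \<le> \<delta> n"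
  proof (rule dependent_wf_choice[of "less_than", simplified])
    fix f :: "nat \<Rightarrow> 'e" and n
    obtain e where "norm e = 1" "\<And>x. x \<in> f ` {..<n} \<Longrightarrow> inner e x = 0"
      "(norm (dual_incl j (blinfun_inner_right e)))\<^sup>2 \<le> \<delta> n"
      using hilbert_schmidt_ex_small_dual[OF assms(1,2), of "f ` {..<n}" "\<delta> n"] assms(3) by blast
    then show "\<exists>e. norm e = 1 \<and> (\<forall>m<n. inner e (f m) = 0) \<and>
        (norm (dual_incl j (blinfun_inner_right e)))\<^sup>2 \<le> \<delta> n"
      by auto
  qed auto
  then obtain f :: "nat \<Rightarrow> 'e" where f: "\<And>n. norm (f n) = 1"
      "\<And>m n. m < n \<Longrightarrow> inner (f n) (f m) = 0"
      "\<And>n. (norm (dual_incl j (blinfun_inner_right (f n))))\<^sup>2 \<le> \<delta> n"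
    by blast
  have "inner (f m) (f n) = (if m = n then 1 else 0)" for m n
    using f(1)[of m] f(2)[of m n] f(2)[of n m]
    by (cases m n rule: linorder_cases) (auto simp: norm_eq_1 inner_commute)
  then show ?thesis
    using f(3) by blast
qed

section \<open>Uncountable disjoint families and translates of the cube\<close>

text \<open>Finite sums of the measures are bounded by the total mass, so the family of measures is
  summable, and a summable family of reals has countable support.\<close>

lemma (in finite_measure) ex_null_of_uncountable_disjoint:
  assumes "uncountable I" and "disjoint_family_on A I" and "\<And>i. i \<in> I \<Longrightarrow> A i \<in> sets M"
  shows "\<exists>i\<in>I. A i \<in> null_sets M"
proof (rule ccontr)
  assume "\<not> ?thesis"
  then have pos: "measure M (A i) \<noteq> 0" if "i \<in> I" for i
    using that assms(3) by (auto simp: null_sets_def emeasure_eq_measure)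
  have "(\<lambda>i. measure M (A i)) summable_on I"
  proof (rule nonneg_bdd_above_summable_on)
    show "bdd_above (sum (\<lambda>i. measure M (A i)) ` {F. F \<subseteq> I \<and> finite F})"
    proof (rule bdd_aboveI2)
      fix F
      assume "F \<in> {F. F \<subseteq> I \<and> finite F}"
      then have "(\<Sum>i\<in>F. measure M (A i)) = measure M (\<Union>i\<in>F. A i)"
        using assms(2,3)
        by (intro finite_measure_finite_Union[symmetric])
          (auto intro: disjoint_family_on_mono)
      also have "\<dots> \<le> measure M (space M)"
        by (rule bounded_measure)
      finally show "(\<Sum>i\<in>F. measure M (A i)) \<le> measure M (space M)" .
    qed
  qed simp
  then have "countable {i \<in> I. measure M (A i) \<noteq> 0}"
    by (rule summable_countable_real)
  moreover have "{i \<in> I. measure M (A i) \<noteq> 0} = I"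
    using pos by blast
  ultimately show False
    using assms(1) by simp
qed

lemma uncountable_UNIV_nat_set: "uncountable (UNIV :: nat set set)"
proof
  assume "countable (UNIV :: nat set set)"
  then obtain g :: "nat \<Rightarrow> nat set" where "range g = UNIV"
    using range_from_nat_into[OF UNIV_not_empty] by blast
  then show False
    using Cantors_theorem[of "UNIV :: nat set"] by auto
qed

text \<open>Only the coordinates along \<open>f\<close> are constrained. If \<open>f\<close> is
  orthonormal but not total, this is an unbounded cylinder over the usual Hilbert cube.\<close>

definition hilbert_cube :: "(nat \<Rightarrow> 'a::real_inner) \<Rightarrow> 'a set" where
  "hilbert_cube f = {z. \<forall>n. \<bar>inner (f n) z\<bar> \<le> (1/2) ^ n}"

lemma closed_hilbert_cube: "closed (hilbert_cube f)"
  unfolding hilbert_cube_def by (intro closed_Collect_all closed_Collect_le continuous_intros)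

text \<open>
  The sums over \<open>n \<in> s\<close> of \<open>3 * (1/2) ^ n *\<^sub>R f n\<close> differ in some coordinate by more than the
  width of the cube.
\<close>

lemma hilbert_cube_ex_disjoint_translates:
  fixes f :: "nat \<Rightarrow> 'a::{real_inner, banach}"
  assumes f: "\<And>m n. inner (f m) (f n) = (if m = n then 1 else 0)"
  obtains y :: "nat set \<Rightarrow> 'a" where "disjoint_family (\<lambda>s. (+) (y s) ` hilbert_cube f)"
proof -
  define g where "g s n = (if n \<in> s then 3 * (1/2) ^ n else 0 :: real) *\<^sub>R f n" for s n
  define y where "y s = (\<Sum>n. g s n)" for s
  have "norm (f n) = 1" for n
    by (simp add: norm_eq_1 f)
  then have "norm (g s n) \<le> 3 * (1/2) ^ n" for s n
    by (simp add: g_def)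
  moreover have "summable (\<lambda>n. 3 * (1/2::real) ^ n)"
    by (intro summable_mult summable_geometric) simp
  ultimately have summable: "summable (g s)" for s
    by (intro summable_comparison_test'[of "\<lambda>n. 3 * (1/2) ^ n" 0 "g s"]) auto
  have coord: "inner (f m) (y s) = (if m \<in> s then 3 * (1/2) ^ m else 0)" for m s
  proof -
    have "inner (f m) (y s) = (\<Sum>n. inner (f m) (g s n))"
      unfolding y_def
      by (rule bounded_linear.suminf[OF bounded_linear_inner_right summable])
    also have "\<dots> = (\<Sum>n\<in>{m}. inner (f m) (g s n))"
      by (intro suminf_finite) (auto simp: g_def f)
    finally show ?thesis
      by (simp add: g_def f)
  qed
  \<comment> \<open>One inclusion suffices: the equation is symmetric in \<open>s\<close> and
    \<open>s'\<close>, so a point common to two translates forces \<open>s = s'\<close>.\<close>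
  have sub: "s \<subseteq> s'" if "y s + z = y s' + z'" "z \<in> hilbert_cube f" "z' \<in> hilbert_cube f" for s s' z z'
  proof
    fix n
    assume "n \<in> s"
    show "n \<in> s'"
    proof (rule ccontr)
      assume "n \<notin> s'"
      have "inner (f n) (y s + z) = inner (f n) (y s' + z')"
        using that(1) by simp
      then have "3 * (1/2) ^ n + inner (f n) z = inner (f n) z'"
        using \<open>n \<in> s\<close> \<open>n \<notin> s'\<close> by (simp add: inner_add_right coord)
      moreover have "\<bar>inner (f n) z\<bar> \<le> (1/2) ^ n" "\<bar>inner (f n) z'\<bar> \<le> (1/2) ^ n"
        using that(2,3) unfolding hilbert_cube_def by blast+
      moreover have "(1/2 :: real) ^ n > 0"
        by simp
      ultimately show False
        by linarith
    qed
  qed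
  have "disjoint_family (\<lambda>s. (+) (y s) ` hilbert_cube f)"
    unfolding disjoint_family_on_def
  proof (intro ballI impI equals0I)
    fix s s' x
    assume "s \<noteq> s'" "x \<in> (+) (y s) ` hilbert_cube f \<inter> (+) (y s') ` hilbert_cube f"
    then show False
      using sub[of s _ s'] sub[of s' _ s] by (metis (no_types, lifting) IntE imageE subset_antisym)
  qed
  then show thesis
    by (rule that)
qed

section \<open>Lower bounds for the mass of the cube and for the resolvent\<close>

text \<open>Chebyshev's inequality in each coordinate and a union bound: the moment bound is chosen
  so that the exceptional probabilities \<open>(1/4) * (1/2) ^ n\<close> sum to 1/2.\<close>

lemma emeasure_hilbert_cube_ge:
  fixes f :: "nat \<Rightarrow> 'a::real_inner"
  assumes "prob_space M" and [measurable_cong]: "sets M = sets borel"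
    and moment: "\<And>n. (\<integral>\<^sup>+z. ennreal ((inner (f n) z)\<^sup>2) \<partial>M) \<le> ennreal ((1/8) ^ n / 4)"
  shows "emeasure M (hilbert_cube f) \<ge> ennreal (1/2)"
proof -
  interpret prob_space M by fact
  have space: "space M = UNIV"
    using sets_eq_imp_space_eq[OF assms(2)] by simp
  have [measurable]: "inner (f n) \<in> borel_measurable borel" for n
    by (intro borel_measurable_continuous_onI continuous_intros)
  \<comment> \<open>The event that the coordinate \<open>n\<close> is at least
    \<open>(1/2) ^ n\<close> in absolute value, squared and rescaled by \<open>4 ^ n\<close> to fit
    Markov's inequality. It includes the boundary, so the union of the \<open>D n\<close> covers the
    complement of the cube.\<close>
  define D where "D n = {z \<in> UNIV. 1 \<le> ennreal (4 ^ n) * ennreal ((inner (f n) z)\<^sup>2)}" for n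
  have D_sets [measurable]: "D n \<in> sets M" for n
    unfolding D_def assms(2) by measurable
  have "emeasure M (D n) \<le> ennreal ((1/4) * (1/2) ^ n)" for n
  proof -
    have "emeasure M (D n) \<le> ennreal (4 ^ n) * (\<integral>\<^sup>+z. ennreal ((inner (f n) z)\<^sup>2) * indicator UNIV z \<partial>M)"
      unfolding D_def using space sets.top[of M]
      by (intro nn_integral_Markov_inequality) auto
    also have "\<dots> \<le> ennreal (4 ^ n) * ennreal ((1/8) ^ n / 4)"
      using moment[of n] by (intro mult_left_mono) auto
    also have "\<dots> = ennreal ((1/4) * (1/2) ^ n)"
      by (simp add: flip: ennreal_mult power_mult_distrib)
    finally show ?thesis .
  qed
  then have "emeasure M (\<Union>n. D n) \<le> (\<Sum>n. ennreal ((1/4) * (1/2) ^ n))"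
    by (intro order_trans[OF emeasure_subadditive_countably] suminf_le) auto
  also have "\<dots> = ennreal (1/2)"
  proof (rule suminf_ennreal_eq)
    show "(\<lambda>n. (1/4) * (1/2 :: real) ^ n) sums (1/2)"
      using sums_mult[OF geometric_sums[of "1/2 :: real"], of "1/4"] by simp
  qed simp
  finally have "emeasure M (\<Union>n. D n) \<le> ennreal (1/2)" .
  moreover have "- hilbert_cube f \<subseteq> (\<Union>n. D n)"
  proof
    fix z
    assume "z \<in> - hilbert_cube f"
    then obtain n where "(1/2) ^ n < \<bar>inner (f n) z\<bar>"
      by (auto simp: hilbert_cube_def not_le)
    then have "((1/2) ^ n)\<^sup>2 \<le> (inner (f n) z)\<^sup>2"
      using abs_le_square_iff[of "(1/2) ^ n" "inner (f n) z"] by simp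
    then have "4 ^ n * ((1/2) ^ n)\<^sup>2 \<le> 4 ^ n * (inner (f n) z)\<^sup>2"
      by (intro mult_left_mono) auto
    moreover have "4 ^ n * ((1/2 :: real) ^ n)\<^sup>2 = (4 * (1/2)\<^sup>2) ^ n"
      by (simp only: power_mult_distrib power_mult[symmetric] mult.commute)
    moreover have "4 * (1/2 :: real)\<^sup>2 = 1"
      by (simp add: power2_eq_square)
    ultimately have "1 \<le> 4 ^ n * (inner (f n) z)\<^sup>2"
      by (simp only: power_one)
    then show "z \<in> (\<Union>n. D n)"
      by (auto simp: D_def ennreal_mult[symmetric])
  qed
  ultimately have "measure M (- hilbert_cube f) \<le> 1/2"
    using finite_measure_mono[of "- hilbert_cube f" "\<Union>n. D n"]
    by (auto simp: emeasure_eq_measure simp del: ennreal_half)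
  moreover have "hilbert_cube f \<in> sets M"
    using closed_hilbert_cube[of f] assms(2) by simp
  ultimately have "measure M (hilbert_cube f) \<ge> 1/2"
    using prob_compl[of "hilbert_cube f"] by (simp add: space Compl_eq_Diff_UNIV)
  then show ?thesis
    by (simp add: emeasure_eq_measure ennreal_leI del: ennreal_half)
qed

lemma transition_op_translate:
  fixes K :: "'a::real_normed_vector set"
  assumes "t > 0" and "K \<in> sets (\<nu> t)"
  shows "transition_op \<nu> t (indicator ((+) y ` K)) y = emeasure (\<nu> t) K"
proof -
  have "transition_op \<nu> t (indicator ((+) y ` K)) y = (\<integral>\<^sup>+w. indicator K w \<partial>\<nu> t)"
    using assms(1) unfolding transition_op_def
    by (auto intro!: nn_integral_cong simp: indicator_def)
  then show ?thesis
    using assms(2) by simp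
qed

text \<open>The times in \<open>{0<..1}\<close> alone contribute enough: there the discount factor
  is at least \<open>exp (- 1)\<close>, and a process started at \<open>y\<close> lies in the
  translate with mass at least \<open>c\<close>. Time 0 is left out because
  \<open>transition_op\<close> is the identity there.\<close>

lemma resolvent_kernel_translate_pos:
  fixes K :: "'a::real_normed_vector set"
  assumes "\<And>t. 0 < t \<Longrightarrow> t \<le> 1 \<Longrightarrow> K \<in> sets (\<nu> t)"
    and "\<And>t. 0 < t \<Longrightarrow> t \<le> 1 \<Longrightarrow> ennreal c \<le> emeasure (\<nu> t) K" and "c > 0"
  shows "resolvent_kernel \<nu> 1 y ((+) y ` K) > 0"
proof -
  let ?g = "\<lambda>t. ennreal (exp (- 1 * t)) * transition_op \<nu> t (indicator ((+) y ` K)) y * indicator {0..} t"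
  have "0 < ennreal (exp (- 1) * c)"
    using assms(3) by simp
  also have "\<dots> = (\<integral>\<^sup>+t. ennreal (exp (- 1) * c) * indicator {0<..1::real} t \<partial>lborel)"
    by (subst nn_integral_cmult_indicator) auto
  \<comment> \<open>The comparison is pointwise with a constant multiple of an indicator, so
    measurability in \<open>t\<close> of the right-hand integrand does not have to be
    established.\<close>
  also have "\<dots> \<le> (\<integral>\<^sup>+t. ?g t \<partial>lborel)"
  proof (rule nn_integral_mono)
    fix t :: real
    show "ennreal (exp (- 1) * c) * indicator {0<..1} t \<le> ?g t"
    proof (cases "0 < t \<and> t \<le> 1")
      case True
      have "ennreal (exp (- 1)) * ennreal c \<le> ennreal (exp (- 1 * t)) * emeasure (\<nu> t) K"
        using True assms(2)[of t] by (intro mult_mono) (auto intro: ennreal_leI)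
      then show ?thesis
        using True assms(1)[of t] assms(3) by (simp add: transition_op_translate ennreal_mult)
    next
      case False
      then show ?thesis
        by (auto simp: indicator_def)
    qed
  qed
  finally show ?thesis
    by (simp add: resolvent_kernel_def resolvent_op_def)
qed

theorem proposition4p5:
  fixes j :: "'h::{real_inner, banach, second_countable_topology} \<Rightarrow> 'e::{real_inner, banach}"
    and \<psi> :: "'h \<Rightarrow> complex"
    and \<nu> :: "real \<Rightarrow> 'e measure"
  assumes embedding: "dense_continuous_embedding j"
    and infinite_dim: "\<not> (\<exists>B :: 'h set. finite B \<and> span B = UNIV)"
    and HS: "hilbert_schmidt j"
    and psi_cont: "continuous_on UNIV \<psi>"
    and psi_negdef: "negative_definite \<psi>"
    and psi_0: "\<psi> 0 = 0"
    and nu_prob: "\<And>t. t > 0 \<Longrightarrow> prob_space (\<nu> t)"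
    and nu_sets: "\<And>t. t > 0 \<Longrightarrow> sets (\<nu> t) = sets borel"
    and nu_char: "\<And>t (\<xi> :: 'e \<Rightarrow>\<^sub>L real). t > 0 \<Longrightarrow>
       (\<integral>z. exp (\<i> * complex_of_real (blinfun_apply \<xi> z)) \<partial>\<nu> t)
         = exp (- complex_of_real t * \<psi> (dual_incl j \<xi>))"
    and H_i: "\<exists>C::real. C > 0 \<and> (\<forall>(\<xi> :: 'e \<Rightarrow>\<^sub>L real) (t::real). t > 0 \<longrightarrow>
       (\<integral>\<^sup>+z. ennreal ((blinfun_apply \<xi> z)\<^sup>2) \<partial>\<nu> t)
         \<le> ennreal (C * (1 + t\<^sup>2) * (norm (dual_incl j \<xi>))\<^sup>2))"
    and H_ii: "\<And>t. t > 0 \<Longrightarrow> range j \<in> null_sets (\<nu> t)"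
  shows "\<not> hypothesis_L (resolvent_kernel \<nu>)"
proof
  obtain C where "C > 0" and C: "\<And>(\<xi> :: 'e \<Rightarrow>\<^sub>L real) t. t > 0 \<Longrightarrow>
      (\<integral>\<^sup>+z. ennreal ((blinfun_apply \<xi> z)\<^sup>2) \<partial>\<nu> t)
        \<le> ennreal (C * (1 + t\<^sup>2) * (norm (dual_incl j \<xi>))\<^sup>2)"
    using H_i by blast
  have "linear j" "inj j"
    using embedding by (auto simp: dense_continuous_embedding_def bounded_linear.linear)
  then have "span F \<noteq> UNIV" if "finite F" for F :: "'e set"
    using infinite_dim that by (rule span_finite_neq_UNIV_of_inj)
  \<comment> \<open>For \<open>t \<le> 1\<close> the factor \<open>C * (1 + t\<^sup>2)\<close> is at
    most \<open>2 * C\<close>, and \<open>2 * C\<close> times this bound is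
    \<open>(1/8) ^ n / 4\<close>, the second moment allowed in the estimate for the cube.\<close>
  moreover have "(1/8) ^ n / (8 * C) > 0" for n
    using \<open>C > 0\<close> by simp
  ultimately obtain f :: "nat \<Rightarrow> 'e" where orth: "\<And>m n. inner (f m) (f n) = (if m = n then 1 else 0)"
    and small: "\<And>n. (norm (dual_incl j (blinfun_inner_right (f n))))\<^sup>2 \<le> (1/8) ^ n / (8 * C)"
    using hilbert_schmidt_ex_orthonormal_seq[OF HS, of "\<lambda>n. (1/8) ^ n / (8 * C)"] by meson
  let ?K = "hilbert_cube f"
  have half: "emeasure (\<nu> t) ?K \<ge> ennreal (1/2)" if "0 < t" "t \<le> 1" for t
  proof (rule emeasure_hilbert_cube_ge[OF nu_prob[OF that(1)] nu_sets[OF that(1)]])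
    fix n
    have "t\<^sup>2 \<le> 1"
      using that by (simp add: power_le_one)
    then have "C * (1 + t\<^sup>2) * (norm (dual_incl j (blinfun_inner_right (f n))))\<^sup>2
        \<le> C * 2 * ((1/8) ^ n / (8 * C))"
      using \<open>C > 0\<close> small[of n] by (intro mult_mono) auto
    also have "\<dots> = (1/8) ^ n / 4"
      using \<open>C > 0\<close> by simp
    finally show "(\<integral>\<^sup>+z. ennreal ((inner (f n) z)\<^sup>2) \<partial>\<nu> t) \<le> ennreal ((1/8) ^ n / 4)"
      using C[OF that(1), of "blinfun_inner_right (f n)"] ennreal_leI order_trans by fastforce
  qed
  have K_sets: "?K \<in> sets (\<nu> t)" if "0 < t" for t
    using nu_sets[OF that] closed_hilbert_cube[of f] by simp
  obtain y :: "nat set \<Rightarrow> 'e" where disjoint: "disjoint_family (\<lambda>s. (+) (y s) ` ?K)"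
    using hilbert_cube_ex_disjoint_translates[OF orth] by blast
  assume "hypothesis_L (resolvent_kernel \<nu>)"
  then obtain \<mu> :: "'e measure" where \<mu>: "sets \<mu> = sets borel" "finite_measure \<mu>"
    and null: "\<And>\<alpha> y A. \<alpha> > 0 \<Longrightarrow> A \<in> null_sets \<mu> \<Longrightarrow> resolvent_kernel \<nu> \<alpha> y A = 0"
    unfolding hypothesis_L_def by blast
  have "(+) (y s) ` ?K \<in> sets \<mu>" for s
    using borel_closed[OF closed_translation[OF closed_hilbert_cube]] \<mu>(1) by simp
  \<comment> \<open>The translates are indexed by all sets of naturals, an uncountable family. The
    null translate is then tested against the resolvent started at its own centre
    \<open>y s\<close>.\<close>
  then obtain s where "(+) (y s) ` ?K \<in> null_sets \<mu>"
    using finite_measure.ex_null_of_uncountable_disjoint[OF \<mu>(2) uncountable_UNIV_nat_set disjoint]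
    by blast
  moreover have "resolvent_kernel \<nu> 1 (y s) ((+) (y s) ` ?K) > 0"
    using half K_sets by (intro resolvent_kernel_translate_pos[where c = "1/2"]) auto
  ultimately show False
    using null[of 1] by simp
qed

end
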